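(* Let $C$ be a Darboux helix in the Myller configuration $M(C,\bar\xi,\pi)$, with axis $\bar l$ and constant angle $\phi$ given by $\langle\bar D,\bar l\rangle=\cos\phi$. Then, in terms of the Frenet-type frame $R_F$, the axis is given by $$\bar l=\cos\phi\,\frac{K_2}{\sqrt{K_1^2+K_2^2}}\,\bar\xi_1\mp\sin\phi\,\bar\xi_2+\cos\phi\,\frac{K_1}{\sqrt{K_1^2+K_2^2}}\,\bar\xi_3.$$
   Context: Let $C$ be a curve in Euclidean space $E^3$ with arclength parameter $s\in I$ ($I$ an interval) and position vector $\bar r(s)$ of the point $P(s)$, let $\bar\xi(s)$ be a unit vector field along $C$ (a versor field $(C,\bar\xi)$), and let $\pi(s)$ be a plane field along $C$ with $\bar\xi(s)\in\pi(s)$. The pair $((C,\bar\xi),(C,\pi))$ is called a Myller configuration $M=M(C,\bar\xi,\pi)$. Put $\bar\xi_1=\bar\xi$, $K_1=\|d\bar\xi/ds\|>0$ (curvature), define $\bar\xi_2$ by $\bar\xi_1'=K_1\bar\xi_2$, and $\bar\xi_3=\bar\xi_1\times\bar\xi_2$. Then $R_F=\{P(s);\bar\xi_1,\bar\xi_2,\bar\xi_3\}$ is a positively oriented orthonormal frame, the Frenet-type frame, and $$\bar\xi_1'=K_1\bar\xi_2,\quad \bar\xi_2'=-K_1\bar\xi_1+K_2\bar\xi_3,\quad \bar\xi_3'=-K_2\bar\xi_2,$$ which defines the torsion $K_2$. A prime denotes $d/ds$. The alternative frame (AF-frame) is the orthonormal frame $R_A=\{P(s);\bar\xi_2,\bar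 Y,\bar D\}$ with $\bar Y=\bar\xi_2'/\|\bar\xi_2'\|$ and $\bar D=\bar\xi_2\times\bar Y=\frac{K_2}{\sqrt{K_1^2+K_2^2}}\bar\xi_1+\frac{K_1}{\sqrt{K_1^2+K_2^2}}\bar\xi_3$. The curve $C$ is called a Darboux helix in $M$ if the versor field $\bar D$ makes a constant angle with a constant versor field (constant unit vector) $\bar l$, called the axis.
   Formalization: The formal theorem assumes in addition that D is not constant along C or that sin φ = 0; without this the claim fails (ξ = (cos s, sin s, 0), D = e₃, l = e₁). The smoothness left implicit is made precise as ξ of class C³. *)

theory Defs
  imports "HOL-Analysis.Analysis"
begin

unbundle cross3_syntax

text \<open>
  All derivatives with respect to arclength are taken within the interval \<open>I\<close>, so \<open>I\<close> may be
  open, half-open or closed; at an endpoint belonging to \<open>I\<close> they are one-sided.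
\<close>

abbreviation dds :: "real set \<Rightarrow> (real \<Rightarrow> 'a::real_normed_vector) \<Rightarrow> real \<Rightarrow> 'a" where
  "dds I f s \<equiv> vector_derivative f (at s within I)"

fun Ck_on :: "nat \<Rightarrow> real set \<Rightarrow> (real \<Rightarrow> 'a::real_normed_vector) \<Rightarrow> bool" where
  "Ck_on 0 I f \<longleftrightarrow> continuous_on I f"
| "Ck_on (Suc k) I f \<longleftrightarrow> f differentiable_on I \<and> Ck_on k I (dds I f)"

definition nontrivial_interval :: "real set \<Rightarrow> bool" where
  "nontrivial_interval I \<longleftrightarrow> is_interval I \<and> (\<exists>a\<in>I. \<exists>b\<in>I. a < b)"

definition arclength_curve :: "real set \<Rightarrow> (real \<Rightarrow> real^3) \<Rightarrow> bool" where
  "arclength_curve I r \<longleftrightarrow> Ck_on 1 I r \<and> (\<forall>s\<in>I. norm (dds I r s) = 1)"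

text \<open>
  A versor field is a unit vector field. Class \<open>C\<^sup>3\<close> is what is needed for the torsion and the
  alternative frame below to be continuously differentiable.
\<close>

definition versor_field :: "real set \<Rightarrow> (real \<Rightarrow> real^3) \<Rightarrow> bool" where
  "versor_field I \<xi> \<longleftrightarrow> Ck_on 3 I \<xi> \<and> (\<forall>s\<in>I. norm (\<xi> s) = 1)"

text \<open>
  The plane at the point \<open>r s\<close> is represented by its direction, a two-dimensional linear subspace;
  the plane itself is the translate of \<open>\<pi> s\<close> by \<open>r s\<close>.
\<close>

definition plane_field :: "real set \<Rightarrow> (real \<Rightarrow> (real^3) set) \<Rightarrow> bool" where
  "plane_field I \<pi> \<longleftrightarrow> (\<forall>s\<in>I. subspace (\<pi> s) \<and> dim (\<pi> s) = 2)"

definition myller_configuration ::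
  "real set \<Rightarrow> (real \<Rightarrow> real^3) \<Rightarrow> (real \<Rightarrow> real^3) \<Rightarrow> (real \<Rightarrow> (real^3) set) \<Rightarrow> bool" where
  "myller_configuration I r \<xi> \<pi> \<longleftrightarrow>
     nontrivial_interval I \<and> arclength_curve I r \<and> versor_field I \<xi> \<and> plane_field I \<pi> \<and>
     (\<forall>s\<in>I. \<xi> s \<in> \<pi> s)"

definition K1 :: "real set \<Rightarrow> (real \<Rightarrow> real^3) \<Rightarrow> real \<Rightarrow> real" where
  "K1 I \<xi> s = norm (dds I \<xi> s)"

definition xi2 :: "real set \<Rightarrow> (real \<Rightarrow> real^3) \<Rightarrow> real \<Rightarrow> real^3" where
  "xi2 I \<xi> s = (1 / K1 I \<xi> s) *\<^sub>R dds I \<xi> s"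

definition xi3 :: "real set \<Rightarrow> (real \<Rightarrow> real^3) \<Rightarrow> real \<Rightarrow> real^3" where
  "xi3 I \<xi> s = \<xi> s \<times> xi2 I \<xi> s"

text \<open>
  The torsion is the \<open>\<xi>\<^sub>3\<close>-coefficient of \<open>\<xi>\<^sub>2'\<close>; that it satisfies the defining equation
  \<open>\<xi>\<^sub>2' = - K\<^sub>1 \<xi>\<^sub>1 + K\<^sub>2 \<xi>\<^sub>3\<close> is proved in \<open>frenet_xi2\<close>.
\<close>

definition K2 :: "real set \<Rightarrow> (real \<Rightarrow> real^3) \<Rightarrow> real \<Rightarrow> real" where
  "K2 I \<xi> s = dds I (xi2 I \<xi>) s \<bullet> xi3 I \<xi> s"

definition AF_Y :: "real set \<Rightarrow> (real \<Rightarrow> real^3) \<Rightarrow> real \<Rightarrow> real^3" where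
  "AF_Y I \<xi> s = (1 / norm (dds I (xi2 I \<xi>) s)) *\<^sub>R dds I (xi2 I \<xi>) s"

definition AF_D :: "real set \<Rightarrow> (real \<Rightarrow> real^3) \<Rightarrow> real \<Rightarrow> real^3" where
  "AF_D I \<xi> s = xi2 I \<xi> s \<times> AF_Y I \<xi> s"

text \<open>
  If \<open>D\<close> is constant along the curve (equivalently \<open>K\<^sub>2/K\<^sub>1\<close> is constant), every unit vector \<open>l\<close>
  makes a constant angle with it, so the axis is not determined by the angle: only \<open>l = D\<close> and
  \<open>l = -D\<close>, i.e. \<open>sin \<phi> = 0\<close>, lie in the plane orthogonal to \<open>Y\<close> for all \<open>s\<close>. Statements that
  determine the axis therefore have to exclude constant \<open>D\<close> with \<open>sin \<phi> \<noteq> 0\<close>.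
\<close>

definition darboux_helix_with ::
  "real set \<Rightarrow> (real \<Rightarrow> real^3) \<Rightarrow> real^3 \<Rightarrow> real \<Rightarrow> bool" where
  "darboux_helix_with I \<xi> l \<phi> \<longleftrightarrow> norm l = 1 \<and> (\<forall>s\<in>I. AF_D I \<xi> s \<bullet> l = cos \<phi>)"

lemma at_within_interval_neq_bot:
  assumes "nontrivial_interval I" "s \<in> I"
  shows "at s within I \<noteq> bot"
proof -
  have "connected I" "\<nexists>x. I = {x}"
    using assms unfolding nontrivial_interval_def is_interval_connected_1 by auto
  then have "s islimpt I"
    using assms(2) connected_imp_perfect by blast
  then show ?thesis
    by (simp add: trivial_limit_within)
qed

lemma dds_eqI:
  assumes "nontrivial_interval I" "s \<in> I" "(f has_vector_derivative f') (at s within I)"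
  shows "dds I f s = f'"
  using vector_derivative_within[OF at_within_interval_neq_bot[OF assms(1,2)] assms(3)] .

lemma dds_works:
  assumes "f differentiable_on I" "s \<in> I"
  shows "(f has_vector_derivative dds I f s) (at s within I)"
  using assms by (simp add: differentiable_on_def vector_derivative_works)

lemma dds_inner:
  assumes I: "nontrivial_interval I" and s: "s \<in> I"
    and f: "f differentiable_on I" and g: "g differentiable_on I"
    and c: "\<And>t. t \<in> I \<Longrightarrow> f t \<bullet> g t = (c::real)"
  shows "dds I f s \<bullet> g s + f s \<bullet> dds I g s = 0"
proof -
  have "((\<lambda>t. f t \<bullet> g t) has_vector_derivative (f s \<bullet> dds I g s + dds I f s \<bullet> g s)) (at s within I)"
    by (rule bounded_bilinear.has_vector_derivative
        [OF bounded_bilinear_inner dds_works[OF f s] dds_works[OF g s]])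
  moreover have "((\<lambda>t. f t \<bullet> g t) has_vector_derivative 0) (at s within I)"
    by (rule has_vector_derivative_transform[where f = "\<lambda>_. c"]) (use s c in auto)
  ultimately have "f s \<bullet> dds I g s + dds I f s \<bullet> g s = 0"
    using vector_derivative_unique_within[OF at_within_interval_neq_bot[OF I s]] by blast
  then show ?thesis by simp
qed

lemma xi2_differentiable:
  assumes \<xi>: "versor_field I \<xi>" and K1: "\<forall>s\<in>I. K1 I \<xi> s > 0"
  shows "xi2 I \<xi> differentiable_on I"
proof -
  have d: "dds I \<xi> differentiable_on I"
    using \<xi> by (simp add: versor_field_def numeral_3_eq_3)
  show ?thesis
    unfolding differentiable_on_def
  proof
    fix s assume s: "s \<in> I"
    have nz: "dds I \<xi> s \<noteq> 0" using bspec[OF K1 s] by (simp add: K1_def)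
    have ds: "dds I \<xi> differentiable (at s within I)"
      using d s by (simp add: differentiable_on_def)
    have n: "(norm \<circ> dds I \<xi>) differentiable (at s within I)"
      by (rule differentiable_chain_within[OF ds])
        (use nz differentiable_norm_at differentiable_at_withinI in blast)
    have i: "(\<lambda>t. 1 / norm (dds I \<xi> t)) differentiable (at s within I)"
      by (rule differentiable_divide) (use n nz in \<open>auto simp: o_def\<close>)
    have "(\<lambda>t. (1 / norm (dds I \<xi> t)) *\<^sub>R dds I \<xi> t) differentiable (at s within I)"
      by (rule differentiable_scaleR[OF i ds])
    moreover have "xi2 I \<xi> = (\<lambda>t. (1 / norm (dds I \<xi> t)) *\<^sub>R dds I \<xi> t)"
      by (auto simp: xi2_def K1_def)
    ultimately show "xi2 I \<xi> differentiable (at s within I)" by simp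
  qed
qed

lemma frame_orthonormal:
  assumes I: "nontrivial_interval I" and \<xi>: "versor_field I \<xi>"
    and K1: "\<forall>s\<in>I. K1 I \<xi> s > 0" and s: "s \<in> I"
  shows "\<xi> s \<bullet> \<xi> s = 1" "xi2 I \<xi> s \<bullet> xi2 I \<xi> s = 1" "xi3 I \<xi> s \<bullet> xi3 I \<xi> s = 1"
    "\<xi> s \<bullet> xi2 I \<xi> s = 0" "\<xi> s \<bullet> xi3 I \<xi> s = 0" "xi2 I \<xi> s \<bullet> xi3 I \<xi> s = 0"
    "xi2 I \<xi> s \<times> xi3 I \<xi> s = \<xi> s"
proof -
  have u: "\<And>t. t \<in> I \<Longrightarrow> \<xi> t \<bullet> \<xi> t = 1"
    using \<xi> by (simp add: versor_field_def flip: power2_norm_eq_inner)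
  have d: "\<xi> differentiable_on I"
    using \<xi> by (simp add: versor_field_def numeral_3_eq_3)
  have o: "\<xi> s \<bullet> dds I \<xi> s = 0"
    using dds_inner[OF I s d d u] by (simp add: inner_commute)
  show 1: "\<xi> s \<bullet> \<xi> s = 1" by (rule u[OF s])
  show 2: "xi2 I \<xi> s \<bullet> xi2 I \<xi> s = 1"
    using bspec[OF K1 s] by (simp add: xi2_def K1_def dot_square_norm power2_eq_square)
  show 3: "\<xi> s \<bullet> xi2 I \<xi> s = 0" using o by (simp add: xi2_def)
  show "xi3 I \<xi> s \<bullet> xi3 I \<xi> s = 1"
    by (simp add: xi3_def dot_cross 1 2 3 inner_commute)
  show "\<xi> s \<bullet> xi3 I \<xi> s = 0" "xi2 I \<xi> s \<bullet> xi3 I \<xi> s = 0"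
    by (simp_all add: xi3_def dot_cross_self)
  show "xi2 I \<xi> s \<times> xi3 I \<xi> s = \<xi> s"
    by (simp add: xi3_def Lagrange 2 3 inner_commute)
qed

lemma frame_expansion:
  fixes a b v :: "real^3"
  assumes "a \<bullet> a = 1" "b \<bullet> b = 1" "a \<bullet> b = 0"
  shows "v = (v \<bullet> a) *\<^sub>R a + (v \<bullet> b) *\<^sub>R b + (v \<bullet> (a \<times> b)) *\<^sub>R (a \<times> b)"
proof -
  define w where "w = v - ((v \<bullet> a) *\<^sub>R a + (v \<bullet> b) *\<^sub>R b + (v \<bullet> (a \<times> b)) *\<^sub>R (a \<times> b))"
  have cc: "(a \<times> b) \<bullet> (a \<times> b) = 1"
    using assms by (simp add: dot_cross inner_commute)
  have wa: "w \<bullet> a = 0" and wb: "w \<bullet> b = 0" and wc: "w \<bullet> (a \<times> b) = 0"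
    using assms cc
    by (simp_all add: w_def inner_diff_left inner_add_left dot_cross_self inner_commute[of b a])
  have "w \<times> (a \<times> b) = 0"
    using wa wb by (simp add: Lagrange)
  then have "w = 0 \<or> a \<times> b = 0"
    using wc norm_and_cross_eq_0 by blast
  then have "w = 0" using cc by auto
  then show ?thesis by (simp add: w_def)
qed

lemma frenet_xi2:
  assumes I: "nontrivial_interval I" and \<xi>: "versor_field I \<xi>"
    and K1: "\<forall>s\<in>I. K1 I \<xi> s > 0" and s: "s \<in> I"
  shows "dds I (xi2 I \<xi>) s = - K1 I \<xi> s *\<^sub>R \<xi> s + K2 I \<xi> s *\<^sub>R xi3 I \<xi> s"
proof -
  note on = frame_orthonormal[OF I \<xi> K1]
  have d1: "\<xi> differentiable_on I"
    using \<xi> by (simp add: versor_field_def numeral_3_eq_3)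
  note d2 = xi2_differentiable[OF \<xi> K1]
  have x1: "dds I \<xi> s = K1 I \<xi> s *\<^sub>R xi2 I \<xi> s"
    using bspec[OF K1 s] by (simp add: xi2_def)
  have "dds I (xi2 I \<xi>) s \<bullet> \<xi> s = - K1 I \<xi> s"
    using dds_inner[OF I s d1 d2 on(4)] on(2)[OF s] by (simp add: x1 inner_commute)
  moreover have "dds I (xi2 I \<xi>) s \<bullet> xi2 I \<xi> s = 0"
    using dds_inner[OF I s d2 d2 on(2)] by (simp add: inner_commute)
  ultimately show ?thesis
    using frame_expansion[OF on(1)[OF s] on(2)[OF s] on(4)[OF s], of "dds I (xi2 I \<xi>) s"]
    by (simp add: K2_def xi3_def)
qed

lemma AF_D_eq:
  assumes I: "nontrivial_interval I" and \<xi>: "versor_field I \<xi>"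
    and K1: "\<forall>s\<in>I. K1 I \<xi> s > 0" and s: "s \<in> I"
  shows "AF_D I \<xi> s =
    (K2 I \<xi> s / sqrt ((K1 I \<xi> s)\<^sup>2 + (K2 I \<xi> s)\<^sup>2)) *\<^sub>R \<xi> s +
    (K1 I \<xi> s / sqrt ((K1 I \<xi> s)\<^sup>2 + (K2 I \<xi> s)\<^sup>2)) *\<^sub>R xi3 I \<xi> s"
proof -
  note on = frame_orthonormal[OF I \<xi> K1 s]
  note f = frenet_xi2[OF I \<xi> K1 s]
  have n: "norm (dds I (xi2 I \<xi>) s) = sqrt ((K1 I \<xi> s)\<^sup>2 + (K2 I \<xi> s)\<^sup>2)"
    by (simp add: norm_eq_sqrt_inner f inner_add_left inner_add_right inner_diff_left
        inner_diff_right on inner_commute power2_eq_square)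
  have "xi2 I \<xi> s \<times> \<xi> s = - xi3 I \<xi> s"
    unfolding xi3_def by (rule cross_skew)
  then have "xi2 I \<xi> s \<times> dds I (xi2 I \<xi>) s =
      K2 I \<xi> s *\<^sub>R \<xi> s + K1 I \<xi> s *\<^sub>R xi3 I \<xi> s"
    unfolding f cross_add_right cross_mult_right on(7) by simp
  then show ?thesis
    by (simp add: AF_D_def AF_Y_def n cross_mult_right scaleR_add_right)
qed

end

theory Submission
  imports Defs
begin

text \<open>
  The whole content concerns the curve \<open>x = \<xi>\<^sub>2\<close> on the unit sphere. It is of class \<open>C\<^sup>2\<close> and
  regular, because \<open>\<xi>\<close> is of class \<open>C\<^sup>3\<close> and \<open>\<parallel>\<xi>\<^sub>2'\<parallel> \<ge> K\<^sub>1 > 0\<close>. With \<open>w = \<parallel>x'\<parallel>\<close>, unit tangent \<open>Y\<close> and \<open>D = x \<times> Y\<close>,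
  the alternative frame satisfies
  \<open>x' = w Y\<close>, \<open>Y' = - w x + g D\<close>, \<open>D' = - g Y\<close>, where \<open>g/w\<close> is the geodesic curvature of \<open>x\<close>.
  If \<open>\<langle>D, l\<rangle> = c\<close> is constant, differentiation gives \<open>g \<langle>Y, l\<rangle> = 0\<close>.

  The axis formula amounts to \<open>\<langle>Y, l\<rangle> = 0\<close> at every parameter: then \<open>\<langle>x, l\<rangle>\<close> has derivative
  \<open>w \<langle>Y, l\<rangle> = 0\<close>, so it is a constant with square \<open>1 - c\<^sup>2 = sin\<^sup>2 \<phi>\<close>, one sign serves the
  whole curve, and \<open>l = c D + \<langle>x, l\<rangle> x\<close>.

  The delicate point is that \<open>g\<close> could vanish on part of the curve without vanishing identically:
  \<open>x\<close> might follow an arc of a great circle, where \<open>D\<close> is constant, and then continue along a small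
  circle about \<open>l\<close> tangent to it. Second order smoothness forbids this, since the geodesic curvature
  would jump. Precisely, on the relatively open set \<open>U = {g \<noteq> 0}\<close> the function \<open>\<langle>Y, l\<rangle>\<close> vanishes
  identically, so its derivative \<open>c g - w \<langle>x, l\<rangle>\<close> vanishes as well and
  \<open>c\<^sup>2 g\<^sup>2 = (1 - c\<^sup>2) w\<^sup>2\<close>. When \<open>c\<^sup>2 \<noteq> 1\<close> this equation characterises \<open>U\<close>, and it is
  a closed condition. As \<open>I\<close> is connected, \<open>U\<close> is empty or all of \<open>I\<close>; it is empty only if \<open>D\<close> is
  constant. That case occurs only together with \<open>sin \<phi> = 0\<close>, and whenever \<open>sin \<phi> = 0\<close> the claim is immediate, because then \<open>l = \<plusminus> D\<close>.

  Differentiability and continuity of the frame come from the closure properties of \<open>C\<^sup>k\<close>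
  functions (\<open>Ck_on_bounded_bilinear\<close>, \<open>Ck_on_inverse_norm\<close>), its equations are
  \<open>spherical_frame_equations\<close>, the connectedness argument is \<open>unit_tangent_orthogonal_axis\<close>, and
  \<open>spherical_axis_decomposition\<close> draws the conclusion about \<open>l\<close>.
\<close>

section \<open>Closure properties of continuously differentiable functions\<close>

lemma Ck_on_cong:
  assumes "Ck_on k I f" "\<And>s. s \<in> I \<Longrightarrow> f s = g s"
  shows "Ck_on k I g"
  using assms
proof (induction k arbitrary: f g)
  case 0
  then show ?case by (simp cong: continuous_on_cong)
next
  case (Suc k)
  have "g differentiable_on I"
    unfolding differentiable_on_def
  proof
    fix s assume s: "s \<in> I"
    have "(f has_vector_derivative dds I f s) (at s within I)"
      using Suc.prems(1) s by (simp add: dds_works)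
    then have "(g has_vector_derivative dds I f s) (at s within I)"
      by (rule has_vector_derivative_transform[OF s, rotated]) (simp add: Suc.prems(2))
    then show "g differentiable (at s within I)"
      by (rule differentiableI_vector)
  qed
  moreover have "dds I f s = dds I g s" if "s \<in> I" for s
    by (rule vector_derivative_cong_eq) (use that Suc.prems(2) in auto)
  ultimately show ?case
    using Suc.IH[of "dds I f" "dds I g"] Suc.prems(1) by simp
qed

lemma Ck_on_SucI:
  assumes I: "nontrivial_interval I"
    and d: "\<And>s. s \<in> I \<Longrightarrow> (f has_vector_derivative f' s) (at s within I)"
    and f': "Ck_on k I f'"
  shows "Ck_on (Suc k) I f"
proof -
  have "f differentiable_on I"
    unfolding differentiable_on_def using d differentiableI_vector by blast
  moreover have "Ck_on k I (dds I f)"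
    by (rule Ck_on_cong[OF f']) (simp add: dds_eqI[OF I _ d])
  ultimately show ?thesis by simp
qed

lemma Ck_on_SucD:
  assumes "Ck_on (Suc k) I f"
  shows "Ck_on k I f"
  using assms
  by (induction k arbitrary: f) (auto intro: differentiable_imp_continuous_on)

lemma Ck_on_const:
  assumes I: "nontrivial_interval I"
  shows "Ck_on k I (\<lambda>_. c)"
proof (induction k arbitrary: c)
  case (Suc k)
  show ?case
    by (rule Ck_on_SucI[OF I has_vector_derivative_const Suc.IH])
qed simp

lemma Ck_on_add:
  assumes I: "nontrivial_interval I" and "Ck_on k I f" "Ck_on k I g"
  shows "Ck_on k I (\<lambda>s. f s + g s)"
  using assms(2,3)
proof (induction k arbitrary: f g)
  case 0
  then show ?case by (simp add: continuous_on_add)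
next
  case (Suc k)
  show ?case
  proof (rule Ck_on_SucI[OF I])
    show "Ck_on k I (\<lambda>s. dds I f s + dds I g s)"
      by (rule Suc.IH) (use Suc.prems in simp_all)
  qed (use Suc.prems in \<open>simp add: dds_works has_vector_derivative_add\<close>)
qed

lemma Ck_on_bounded_bilinear:
  assumes I: "nontrivial_interval I" and b: "bounded_bilinear b"
    and "Ck_on k I f" "Ck_on k I g"
  shows "Ck_on k I (\<lambda>s. b (f s) (g s))"
  using assms(3,4)
proof (induction k arbitrary: f g)
  case 0
  then show ?case by (simp add: bounded_bilinear.continuous_on[OF b])
next
  case (Suc k)
  show ?case
  proof (rule Ck_on_SucI[OF I])
    show "Ck_on k I (\<lambda>s. b (f s) (dds I g s) + b (dds I f s) (g s))"
      by (intro Ck_on_add[OF I] Suc.IH) (use Suc.prems Ck_on_SucD in auto)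
  qed (use Suc.prems in
      \<open>simp add: dds_works bounded_bilinear.has_vector_derivative[OF b]\<close>)
qed

text \<open>
  The reciprocal norm \<open>\<rho>\<close> satisfies \<open>\<rho>' = - \<rho>\<^sup>3 \<langle>f, f'\<rangle>\<close>. Since \<open>\<rho>\<close> itself is the only
  nonpolynomial ingredient on the right, its smoothness follows from that of \<open>f\<close> by induction.
\<close>

lemma Ck_on_inverse_norm:
  fixes f :: "real \<Rightarrow> 'a::real_inner"
  assumes I: "nontrivial_interval I" and "Ck_on k I f" and nz: "\<forall>s\<in>I. f s \<noteq> 0"
  shows "Ck_on k I (\<lambda>s. 1 / norm (f s))"
  using assms(2)
proof (induction k)
  case 0
  then show ?case using nz by (auto intro!: continuous_intros)
next
  case (Suc k)
  let ?\<rho> = "\<lambda>s. 1 / norm (f s)"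
  have \<rho>: "Ck_on k I ?\<rho>"
    by (rule Suc.IH[OF Ck_on_SucD[OF Suc.prems]])
  show ?case
  proof (rule Ck_on_SucI[OF I])
    have ff': "Ck_on k I (\<lambda>s. f s \<bullet> dds I f s)"
      by (rule Ck_on_bounded_bilinear[OF I bounded_bilinear_inner])
        (use Suc.prems Ck_on_SucD in auto)
    show "Ck_on k I (\<lambda>s. (-1) * ((?\<rho> s * (?\<rho> s * ?\<rho> s)) * (f s \<bullet> dds I f s)))"
      by (intro Ck_on_bounded_bilinear[OF I bounded_bilinear_mult] Ck_on_const[OF I] \<rho> ff')
  next
    fix s assume s: "s \<in> I"
    have fs: "(f has_derivative (\<lambda>h. h *\<^sub>R dds I f s)) (at s within I)"
      using dds_works[of f I s] Suc.prems s by (simp add: has_vector_derivative_def)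
    have n: "((\<lambda>t. norm (f t)) has_derivative (\<lambda>h. (h *\<^sub>R dds I f s) \<bullet> sgn (f s))) (at s within I)"
      by (rule has_derivative_compose[OF fs has_derivative_norm[OF bspec[OF nz s]]])
    have "(?\<rho> has_derivative
        (\<lambda>h. - 1 * (inverse (norm (f s)) * ((h *\<^sub>R dds I f s) \<bullet> sgn (f s)) * inverse (norm (f s)))))
        (at s within I)"
      using Deriv.has_derivative_inverse[OF _ n] bspec[OF nz s] by (simp add: inverse_eq_divide)
    then show "(?\<rho> has_vector_derivative
        (-1) * ((?\<rho> s * (?\<rho> s * ?\<rho> s)) * (f s \<bullet> dds I f s))) (at s within I)"
      unfolding has_vector_derivative_def
      by (rule has_derivative_eq_rhs)
        (auto simp: fun_eq_iff sgn_div_norm inner_commute field_simps)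
  qed
qed

section \<open>The moving frame of a regular spherical curve\<close>

definition unit_tangent :: "real set \<Rightarrow> (real \<Rightarrow> real^3) \<Rightarrow> real \<Rightarrow> real^3" where
  "unit_tangent I x s = (1 / norm (dds I x s)) *\<^sub>R dds I x s"

text \<open>
  For a curve on the unit sphere this is the unit normal within the sphere, the third vector of
  the positively oriented frame that starts with the position vector and the unit tangent.
\<close>

definition conormal :: "real set \<Rightarrow> (real \<Rightarrow> real^3) \<Rightarrow> real \<Rightarrow> real^3" where
  "conormal I x s = x s \<times> unit_tangent I x s"

lemma Ck_on_unit_tangent:
  assumes I: "nontrivial_interval I" and x: "Ck_on (Suc k) I x"
    and nz: "\<forall>s\<in>I. dds I x s \<noteq> 0"
  shows "Ck_on k I (unit_tangent I x)"
proof -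
  have "Ck_on k I (dds I x)" using x by simp
  then show ?thesis
    unfolding unit_tangent_def[abs_def]
    by (intro Ck_on_bounded_bilinear[OF I bounded_bilinear_scaleR] Ck_on_inverse_norm[OF I] nz)
qed

lemma Ck_on_conormal:
  assumes I: "nontrivial_interval I" and x: "Ck_on (Suc k) I x"
    and nz: "\<forall>s\<in>I. dds I x s \<noteq> 0"
  shows "Ck_on k I (conormal I x)"
  unfolding conormal_def[abs_def]
  by (rule Ck_on_bounded_bilinear[OF I bilinear_cross[unfolded bilinear_conv_bounded_bilinear]
        Ck_on_SucD[OF x] Ck_on_unit_tangent[OF I x nz]])

lemma spherical_frame_orthonormal:
  assumes I: "nontrivial_interval I" and x: "x differentiable_on I"
    and unit: "\<forall>s\<in>I. norm (x s) = 1"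
    and nz: "\<forall>s\<in>I. dds I x s \<noteq> 0" and s: "s \<in> I"
  shows "x s \<bullet> x s = 1" "unit_tangent I x s \<bullet> unit_tangent I x s = 1"
    "conormal I x s \<bullet> conormal I x s = 1"
    "x s \<bullet> unit_tangent I x s = 0" "x s \<bullet> conormal I x s = 0"
    "unit_tangent I x s \<bullet> conormal I x s = 0"
    "dds I x s = norm (dds I x s) *\<^sub>R unit_tangent I x s"
proof -
  have u: "x t \<bullet> x t = 1" if "t \<in> I" for t
    using bspec[OF unit that] by (simp flip: power2_norm_eq_inner)
  show 1: "x s \<bullet> x s = 1" by (rule u[OF s])
  show 2: "unit_tangent I x s \<bullet> unit_tangent I x s = 1"
    using bspec[OF nz s] by (simp add: unit_tangent_def dot_square_norm power2_eq_square)
  show 3: "x s \<bullet> unit_tangent I x s = 0"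
    using dds_inner[OF I s x x u] by (simp add: unit_tangent_def inner_commute)
  show "conormal I x s \<bullet> conormal I x s = 1"
    by (simp add: conormal_def dot_cross 1 2 3 inner_commute)
  show "x s \<bullet> conormal I x s = 0" "unit_tangent I x s \<bullet> conormal I x s = 0"
    by (simp_all add: conormal_def dot_cross_self)
  show "dds I x s = norm (dds I x s) *\<^sub>R unit_tangent I x s"
    using bspec[OF nz s] by (simp add: unit_tangent_def)
qed

text \<open>
  The derivative of an orthonormal frame is skew-symmetric, and the position vector has no conormal
  component in its derivative; this leaves the speed and one further coefficient.
\<close>

lemma spherical_frame_equations:
  assumes I: "nontrivial_interval I" and x: "Ck_on 2 I x"
    and unit: "\<forall>s\<in>I. norm (x s) = 1"
    and nz: "\<forall>s\<in>I. dds I x s \<noteq> 0" and s: "s \<in> I"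
  defines "g \<equiv> dds I (unit_tangent I x) s \<bullet> conormal I x s"
  shows "dds I (unit_tangent I x) s = - norm (dds I x s) *\<^sub>R x s + g *\<^sub>R conormal I x s"
    "dds I (conormal I x) s = - g *\<^sub>R unit_tangent I x s"
proof -
  have x2: "Ck_on (Suc 1) I x" using x by (simp add: numeral_2_eq_2)
  have dx: "x differentiable_on I" using x2 by simp
  have dT: "unit_tangent I x differentiable_on I"
    using Ck_on_unit_tangent[OF I x2 nz] by simp
  have dN: "conormal I x differentiable_on I"
    using Ck_on_conormal[OF I x2 nz] by simp
  note on = spherical_frame_orthonormal[OF I dx unit nz]
  note os = on[OF s]
  have Tx: "dds I (unit_tangent I x) s \<bullet> x s = - norm (dds I x s)"
    using dds_inner[OF I s dx dT on(4)] arg_cong[OF os(7), of "\<lambda>v. v \<bullet> unit_tangent I x s"] os(2)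
    by (simp add: inner_commute)
  have TT: "dds I (unit_tangent I x) s \<bullet> unit_tangent I x s = 0"
    using dds_inner[OF I s dT dT on(2)] by (simp add: inner_commute)
  have Nx: "dds I (conormal I x) s \<bullet> x s = 0"
    using dds_inner[OF I s dx dN on(5)] arg_cong[OF os(7), of "\<lambda>v. v \<bullet> conormal I x s"] os(6)
    by (simp add: inner_commute)
  have NT: "dds I (conormal I x) s \<bullet> unit_tangent I x s = - g"
    using dds_inner[OF I s dT dN on(6)] by (simp add: g_def inner_commute)
  have NN: "dds I (conormal I x) s \<bullet> conormal I x s = 0"
    using dds_inner[OF I s dN dN on(3)] by (simp add: inner_commute)
  note e = frame_expansion[OF os(1,2,4), folded conormal_def]
  show "dds I (unit_tangent I x) s = - norm (dds I x s) *\<^sub>R x s + g *\<^sub>R conormal I x s"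
    using e[of "dds I (unit_tangent I x) s"] by (simp add: Tx TT g_def)
  show "dds I (conormal I x) s = - g *\<^sub>R unit_tangent I x s"
    using e[of "dds I (conormal I x) s"] by (simp add: Nx NT NN)
qed

section \<open>Spherical curves whose conormal makes a constant angle with a fixed direction\<close>

lemma dds_inner_const:
  fixes f :: "real \<Rightarrow> 'a::real_inner"
  assumes "f differentiable_on I" "s \<in> I"
  shows "((\<lambda>t. f t \<bullet> l) has_vector_derivative dds I f s \<bullet> l) (at s within I)"
  by (rule bounded_linear.has_vector_derivative[OF bounded_linear_inner_left dds_works[OF assms]])

text \<open>
  This is the connectedness argument: the points where the conormal turns form a subset of the
  interval that is both open and closed, so an inflection arc cannot be joined to a turning arc.
\<close>

lemma unit_tangent_orthogonal_axis:
  assumes I: "nontrivial_interval I" and x: "Ck_on 2 I x"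
    and unit: "\<forall>s\<in>I. norm (x s) = 1"
    and nz: "\<forall>s\<in>I. dds I x s \<noteq> 0"
    and l: "norm l = 1" and c: "\<forall>s\<in>I. conormal I x s \<bullet> l = c" and c1: "c\<^sup>2 \<noteq> 1"
    and nonconst: "\<not> conormal I x constant_on I" and s: "s \<in> I"
  shows "unit_tangent I x s \<bullet> l = 0"
proof -
  define T where "T = unit_tangent I x"
  define N where "N = conormal I x"
  define w where "w t = norm (dds I x t)" for t
  define g where "g t = dds I T t \<bullet> N t" for t
  define U where "U = {t\<in>I. g t \<noteq> 0}"
  have x2: "Ck_on (Suc 1) I x" using x by (simp add: numeral_2_eq_2)
  have dx: "x differentiable_on I" using x2 by simp
  have T1: "Ck_on 1 I T" unfolding T_def by (rule Ck_on_unit_tangent[OF I x2 nz])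
  have N1: "Ck_on 1 I N" unfolding N_def by (rule Ck_on_conormal[OF I x2 nz])
  have dT: "T differentiable_on I" and dN: "N differentiable_on I" using T1 N1 by simp_all
  note on = spherical_frame_orthonormal[OF I dx unit nz, folded T_def N_def w_def]
  note fe = spherical_frame_equations[OF I x unit nz, folded T_def N_def, folded w_def g_def]
  have w: "continuous_on I w" unfolding w_def using x2
    by (intro continuous_intros differentiable_imp_continuous_on) simp
  have g: "continuous_on I g" unfolding g_def
  proof (intro continuous_intros)
    show "continuous_on I (dds I T)" using T1 by simp
  qed (rule differentiable_imp_continuous_on[OF dN])
  have gT: "g t * (T t \<bullet> l) = 0" if t: "t \<in> I" for t
  proof -
    have "dds I N t \<bullet> l = 0"
      using vector_derivative_unique_within[OF at_within_interval_neq_bot[OF I t]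
          dds_inner_const[OF dN t, of l]
          has_vector_derivative_transform[OF t _ has_vector_derivative_const[of c]]]
        c by (simp add: N_def)
    then show ?thesis using fe(2)[OF t] by simp
  qed
  have openU: "openin (top_of_set I) U"
  proof -
    have "U = I \<inter> g -` (- {0})" by (auto simp: U_def)
    then show ?thesis
      using continuous_openin_preimage_gen[OF g, of "- {0}"] by auto
  qed
  \<comment> \<open>Near a point of \<open>U\<close> the product \<open>T \<bullet> l\<close> vanishes identically, so it may be differentiated
    there; the unit length of \<open>l\<close> then eliminates \<open>x \<bullet> l\<close>.\<close>
  have key: "(c * g t)\<^sup>2 = (1 - c\<^sup>2) * (w t)\<^sup>2" if t: "t \<in> U" for t
  proof -
    have tI: "t \<in> I" using t by (simp add: U_def)
    obtain d where d: "d > 0" "\<And>t'. t' \<in> I \<Longrightarrow> dist t' t < d \<Longrightarrow> t' \<in> U"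
      using openU t unfolding openin_euclidean_subtopology_iff by blast
    have T0: "T t' \<bullet> l = 0" if "t' \<in> U" for t'
      using gT[of t'] that by (simp add: U_def)
    have "((\<lambda>t. T t \<bullet> l) has_vector_derivative 0) (at t within I)"
      by (rule has_vector_derivative_transform_within[OF has_vector_derivative_const[of 0] d(1) tI])
        (simp add: T0 d(2))
    then have "dds I T t \<bullet> l = 0"
      using vector_derivative_unique_within[OF at_within_interval_neq_bot[OF I tI]
          dds_inner_const[OF dT tI, of l]] by blast
    then have 1: "c * g t = w t * (x t \<bullet> l)"
      using fe(1)[OF tI] bspec[OF c tI] by (simp add: inner_add_left inner_diff_left N_def mult.commute)
    have le: "l = (x t \<bullet> l) *\<^sub>R x t + c *\<^sub>R N t"
    proof -
      have "l \<bullet> T t = 0" "l \<bullet> N t = c" "x t \<times> T t = N t"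
        using T0[OF t] bspec[OF c tI]
        by (simp_all add: inner_commute N_def T_def conormal_def)
      then show ?thesis
        using frame_expansion[OF on(1,2,4)[OF tI], of l]
        by (metis add_0_right inner_commute scaleR_zero_left)
    qed
    have "1 = l \<bullet> l" using l by (simp flip: power2_norm_eq_inner)
    also have "\<dots> = (x t \<bullet> l) * (x t \<bullet> l) + c * (N t \<bullet> l)"
      by (subst (1) le) (simp add: inner_add_left)
    finally have "(x t \<bullet> l)\<^sup>2 = 1 - c\<^sup>2"
      using bspec[OF c tI] by (simp add: N_def power2_eq_square)
    then show ?thesis by (simp add: 1 power_mult_distrib)
  qed
  \<comment> \<open>Conversely, \<open>c\<^sup>2 \<noteq> 1\<close> and \<open>w > 0\<close> make the right-hand side nonzero, which forces
    \<open>g \<noteq> 0\<close>. An equation between continuous functions is a closed condition.\<close>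
  have "U = {t\<in>I. (c * g t)\<^sup>2 = (1 - c\<^sup>2) * (w t)\<^sup>2}"
  proof -
    have "t \<in> U" if "t \<in> I" "(c * g t)\<^sup>2 = (1 - c\<^sup>2) * (w t)\<^sup>2" for t
      using that c1 nz by (auto simp: U_def w_def)
    then show ?thesis using key by (auto simp: U_def)
  qed
  then have "U = I \<inter> (\<lambda>t. (c * g t)\<^sup>2 - (1 - c\<^sup>2) * (w t)\<^sup>2) -` {0}" by auto
  moreover have "continuous_on I (\<lambda>t. (c * g t)\<^sup>2 - (1 - c\<^sup>2) * (w t)\<^sup>2)"
    by (intro continuous_intros g w)
  ultimately have closedU: "closedin (top_of_set I) U"
    using continuous_closedin_preimage[of I _ "{0}"] by auto
  have "U \<noteq> {}"
  proof
    assume "U = {}"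
    then have "dds I N t = 0" if "t \<in> I" for t
      using fe(2)[OF that] that by (auto simp: U_def)
    then have "(N has_vector_derivative 0) (at t within I)" if "t \<in> I" for t
      using dds_works[OF dN that] that by simp
    moreover have "convex I"
      using I by (simp add: nontrivial_interval_def is_interval_convex)
    ultimately obtain k where "\<And>t. t \<in> I \<Longrightarrow> N t = k"
      using has_vector_derivative_zero_constant by blast
    then show False using nonconst by (auto simp: constant_on_def N_def)
  qed
  moreover have "connected I"
    using I by (simp add: nontrivial_interval_def is_interval_connected_1)
  ultimately have "U = I"
    using openU closedU by (auto simp: connected_clopen)
  then show ?thesis using gT[OF s] s by (auto simp: U_def T_def)
qed

section \<open>The axis of a Darboux helix\<close>

text \<open>
  The coefficient \<open>m\<close> is \<open>\<langle>x, l\<rangle>\<close>. It is constant because the tangential component of \<open>l\<close>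
  vanishes, and \<open>\<parallel>l\<parallel> = 1\<close> then leaves only two values for it, so the sign does not depend on the
  parameter.
\<close>

lemma spherical_axis_decomposition:
  assumes I: "nontrivial_interval I" and x: "Ck_on 2 I x"
    and unit: "\<forall>s\<in>I. norm (x s) = 1"
    and nz: "\<forall>s\<in>I. dds I x s \<noteq> 0"
    and l: "norm l = 1" and angle: "\<forall>s\<in>I. conormal I x s \<bullet> l = cos \<phi>"
    and nondeg: "\<not> conormal I x constant_on I \<or> sin \<phi> = 0"
  shows "\<exists>m\<in>{- sin \<phi>, sin \<phi>}. \<forall>s\<in>I. l = cos \<phi> *\<^sub>R conormal I x s + m *\<^sub>R x s"
proof -
  have dx: "x differentiable_on I" using x by (simp add: numeral_2_eq_2)
  note on = spherical_frame_orthonormal[OF I dx unit nz]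
  have expand: "l = (x s \<bullet> l) *\<^sub>R x s + (unit_tangent I x s \<bullet> l) *\<^sub>R unit_tangent I x s
      + cos \<phi> *\<^sub>R conormal I x s" if "s \<in> I" for s
  proof -
    have "l = (l \<bullet> x s) *\<^sub>R x s + (l \<bullet> unit_tangent I x s) *\<^sub>R unit_tangent I x s
        + (l \<bullet> conormal I x s) *\<^sub>R conormal I x s"
      unfolding conormal_def by (rule frame_expansion[OF on(1,2,4)[OF that]])
    also have "\<dots> = (x s \<bullet> l) *\<^sub>R x s + (unit_tangent I x s \<bullet> l) *\<^sub>R unit_tangent I x s
      + cos \<phi> *\<^sub>R conormal I x s"
      using bspec[OF angle that] by (simp add: inner_commute)
    finally show ?thesis .
  qed
  have pyth: "(x s \<bullet> l)\<^sup>2 + (unit_tangent I x s \<bullet> l)\<^sup>2 = (sin \<phi>)\<^sup>2" if s: "s \<in> I" for s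
  proof -
    have "1 = l \<bullet> l" using l by (simp flip: power2_norm_eq_inner)
    also have "\<dots> = (x s \<bullet> l) * (x s \<bullet> l) + (unit_tangent I x s \<bullet> l) * (unit_tangent I x s \<bullet> l)
        + cos \<phi> * (conormal I x s \<bullet> l)"
      by (subst (1) expand[OF s]) (simp add: inner_add_left)
    finally show ?thesis
      using sin_cos_squared_add[of \<phi>] bspec[OF angle s] by (simp add: power2_eq_square)
  qed
  have T0: "unit_tangent I x s \<bullet> l = 0" if s: "s \<in> I" for s
  proof (cases "sin \<phi> = 0")
    case True
    then show ?thesis using pyth[OF s] by (simp add: sum_power2_eq_zero_iff)
  next
    case False
    then have "(cos \<phi>)\<^sup>2 \<noteq> 1" by (simp add: cos_squared_eq)
    then show ?thesis
      using unit_tangent_orthogonal_axis[OF I x unit nz l angle _ _ s] nondeg False by blast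
  qed
  have "((\<lambda>t. x t \<bullet> l) has_vector_derivative 0) (at s within I)" if s: "s \<in> I" for s
  proof -
    have "dds I x s \<bullet> l = 0"
      using arg_cong[OF on(7)[OF s], of "\<lambda>v. v \<bullet> l"] T0[OF s] by simp
    then show ?thesis using dds_inner_const[OF dx s, of l] by simp
  qed
  moreover have "convex I"
    using I by (simp add: nontrivial_interval_def is_interval_convex)
  ultimately obtain m where m: "\<And>s. s \<in> I \<Longrightarrow> x s \<bullet> l = m"
    using has_vector_derivative_zero_constant[of I "\<lambda>t. x t \<bullet> l"] by blast
  obtain s where s: "s \<in> I" using I by (auto simp: nontrivial_interval_def)
  have "m\<^sup>2 = (sin \<phi>)\<^sup>2" using pyth[OF s] T0[OF s] m[OF s] by simp
  then have "m \<in> {- sin \<phi>, sin \<phi>}" by (auto simp: power2_eq_iff)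
  moreover have "l = cos \<phi> *\<^sub>R conormal I x s + m *\<^sub>R x s" if "s \<in> I" for s
  proof -
    have "(x s \<bullet> l) *\<^sub>R x s + (unit_tangent I x s \<bullet> l) *\<^sub>R unit_tangent I x s
        + cos \<phi> *\<^sub>R conormal I x s = cos \<phi> *\<^sub>R conormal I x s + m *\<^sub>R x s"
      by (simp add: T0[OF that] m[OF that])
    with expand[OF that] show ?thesis by (rule trans)
  qed
  ultimately show ?thesis by blast
qed

theorem corollary12:
  fixes I :: "real set" and r \<xi> :: "real \<Rightarrow> real^3" and \<pi> :: "real \<Rightarrow> (real^3) set"
    and l :: "real^3" and \<phi> :: real
  assumes M: "myller_configuration I r \<xi> \<pi>"
    and K1_pos: "\<forall>s\<in>I. K1 I \<xi> s > 0"
    and helix: "darboux_helix_with I \<xi> l \<phi>"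
    and nondegenerate: "\<not> AF_D I \<xi> constant_on I \<or> sin \<phi> = 0"
  shows "(\<forall>s\<in>I. l =
            (cos \<phi> * (K2 I \<xi> s / sqrt ((K1 I \<xi> s)\<^sup>2 + (K2 I \<xi> s)\<^sup>2))) *\<^sub>R \<xi> s
            - sin \<phi> *\<^sub>R xi2 I \<xi> s
            + (cos \<phi> * (K1 I \<xi> s / sqrt ((K1 I \<xi> s)\<^sup>2 + (K2 I \<xi> s)\<^sup>2))) *\<^sub>R xi3 I \<xi> s)
       \<or> (\<forall>s\<in>I. l =
            (cos \<phi> * (K2 I \<xi> s / sqrt ((K1 I \<xi> s)\<^sup>2 + (K2 I \<xi> s)\<^sup>2))) *\<^sub>R \<xi> s
            + sin \<phi> *\<^sub>R xi2 I \<xi> s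
            + (cos \<phi> * (K1 I \<xi> s / sqrt ((K1 I \<xi> s)\<^sup>2 + (K2 I \<xi> s)\<^sup>2))) *\<^sub>R xi3 I \<xi> s)"
proof -
  have I: "nontrivial_interval I" and v: "versor_field I \<xi>"
    using M by (simp_all add: myller_configuration_def)
  have x_eq: "xi2 I \<xi> = unit_tangent I \<xi>"
    by (simp add: fun_eq_iff xi2_def K1_def unit_tangent_def)
  have D_eq: "AF_D I \<xi> = conormal I (xi2 I \<xi>)"
    by (simp add: fun_eq_iff AF_D_def AF_Y_def conormal_def unit_tangent_def)
  have x: "Ck_on 2 I (xi2 I \<xi>)"
    unfolding x_eq
  proof (rule Ck_on_unit_tangent[OF I])
    show "Ck_on (Suc 2) I \<xi>" using v by (simp add: versor_field_def)
    show "\<forall>s\<in>I. dds I \<xi> s \<noteq> 0"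
      using K1_pos by (auto simp: K1_def)
  qed
  have unit: "\<forall>s\<in>I. norm (xi2 I \<xi> s) = 1"
    using frame_orthonormal(2)[OF I v K1_pos] by (simp add: norm_eq_1)
  \<comment> \<open>The \<open>\<xi>\<close>-component of \<open>\<xi>\<^sub>2'\<close> is \<open>- K\<^sub>1\<close>.\<close>
  have nz: "\<forall>s\<in>I. dds I (xi2 I \<xi>) s \<noteq> 0"
  proof (intro ballI notI)
    fix s assume s: "s \<in> I"
    note on = frame_orthonormal[OF I v K1_pos s]
    assume "dds I (xi2 I \<xi>) s = 0"
    then have "(- K1 I \<xi> s *\<^sub>R \<xi> s + K2 I \<xi> s *\<^sub>R xi3 I \<xi> s) \<bullet> \<xi> s = 0"
      using frenet_xi2[OF I v K1_pos s] by simp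
    then have "K1 I \<xi> s = 0"
      using on(1,5)
      by (simp only: inner_add_left inner_scaleR_left inner_commute[of "xi3 I \<xi> s"])
    then show False using bspec[OF K1_pos s] by simp
  qed
  have l: "norm l = 1" and angle: "\<forall>s\<in>I. conormal I (xi2 I \<xi>) s \<bullet> l = cos \<phi>"
    using helix by (simp_all add: darboux_helix_with_def D_eq)
  obtain m where m: "m = - sin \<phi> \<or> m = sin \<phi>"
      "\<And>s. s \<in> I \<Longrightarrow> l = cos \<phi> *\<^sub>R AF_D I \<xi> s + m *\<^sub>R xi2 I \<xi> s"
    using spherical_axis_decomposition[OF I x unit nz l angle nondegenerate[unfolded D_eq]]
    unfolding D_eq by blast
  have "l =
      (cos \<phi> * (K2 I \<xi> s / sqrt ((K1 I \<xi> s)\<^sup>2 + (K2 I \<xi> s)\<^sup>2))) *\<^sub>R \<xi> s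
      + m *\<^sub>R xi2 I \<xi> s
      + (cos \<phi> * (K1 I \<xi> s / sqrt ((K1 I \<xi> s)\<^sup>2 + (K2 I \<xi> s)\<^sup>2))) *\<^sub>R xi3 I \<xi> s"
    if s: "s \<in> I" for s
    using m(2)[OF s] unfolding AF_D_eq[OF I v K1_pos s]
    by (simp only: scaleR_add_right scaleR_scaleR add_ac)
  then show ?thesis
    using m(1) by (metis (no_types, lifting) diff_conv_add_uminus scaleR_minus_left)
qed

end
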